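(* Let $(M,g)$ be a complete Riemannian manifold of dimension $n\in\mathbb N$, let $T>0$, let $(U,d)$ be a metric space, let $f:[0,T]\times M\times U\to TM$ with $f(t,x,u)\in T_xM$ and $f^0:[0,T]\times M\times U\to\mathbb R$ be maps, and let $\Gamma:[0,T]\times M\to 2^U$ be a set-valued map. Assume that for a.e. $t\in(0,T)$ one of the following conditions holds: (A3$'$) $\Gamma(t,\cdot):M\to 2^U$ is upper semicontinuous, and for any $y\in M$ and $\epsilon>0$ there exists $\sigma\in(0,i(y))$ such that $$|L_{y'y}f(t,y',u')-f(t,y,u)|<\epsilon\quad\text{and}\quad f^0(t,y',u')>f^0(t,y,u)-\epsilon$$ for all $(y',u',u)\in M\times U\times U$ with $\max\{\rho(y,y'),d(u,u')\}<\sigma$. (A4$'$) $\Gamma(t,x)\equiv\Gamma(t)$ for all $x\in M$ (i.e. $\Gamma(t,x)$ does not depend on $x$), and for any $y\in M$ and $\epsilon>0$ there exists $\sigma\in(0,i(y))$ such that $$|L_{y'y}f(t,y',u)-f(t,y,u)|<\epsilon\quad\text{and}\quad f^0(t,y',u)>f^0(t,y,u)-\epsilon$$ for all $(y',u)\in M\times U$ with $\rho(y,y')<\sigma$. Then, for a.e. $t\in(0,T)$, the map $\mathcal E(t,\cdot)$ satisfies the Cesari-type property on $M$, i.e. $$\bigcap_{i(x)>\delta>0}\mathrm{cl}\,\mathrm{co}\Big(\bigcup_{\rho(y,x)<\delta}L_{yx}\mathcal E(t,y)\Big)=\mathcal E(t,x)\qquad\text{for all }x\in M,$$ if and only if $\mathcal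 E(t,x)$ is convex and closed for each $x\in M$.
   Context: $|\cdot|$ is the norm on $T_xM$ induced by $g$; $\rho(\cdot,\cdot)$ is the Riemannian distance; $i(x)$ is the injectivity radius at $x\in M$. For $x,y\in M$ with $\rho(x,y)<i(y)$, $L_{xy}$ denotes parallel translation (for the Levi-Civita connection) from $x$ to $y$ along the unique shortest geodesic connecting $x$ and $y$. For a.e. $t\in(0,T)$ and each $x\in M$, $$\mathcal E(t,x)=\{(x^0,X)\in\mathbb R\times T_xM\mid \exists\,u\in\Gamma(t,x)\text{ such that }x^0\ge f^0(t,x,u)\text{ and }X=f(t,x,u)\},$$ and, if $\rho(x,y)<i(y)$, $L_{xy}\mathcal E(t,x)=\{(x^0,L_{xy}X)\mid (x^0,X)\in\mathcal E(t,x)\}\subseteq\mathbb R\times T_yM$. $\mathrm{cl}$ and $\mathrm{co}$ denote closure and convex hull (here in the finite-dimensional vector space $\mathbb R\times T_xM$). $\Gamma(t,\cdot)$ is upper semicontinuous if for each $x\in M$ and each neighborhood $\mathcal O$ of $\Gamma(t,x)$ in $U$ there exists $\delta>0$ such that $\Gamma(t,y)\subseteq\mathcal O$ for all $y\in M$ with $\rho(x,y)<\delta$. *)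

theory Defs
  imports "HOL-Analysis.Analysis"
begin

section \<open>Smooth maps and smooth manifolds\<close>

text \<open>Differentiability of order \<open>k\<close> on an open set, by recursion on directional derivatives.\<close>

primrec ck_on :: "nat \<Rightarrow> 'a::real_normed_vector set \<Rightarrow> ('a \<Rightarrow> 'b::real_normed_vector) \<Rightarrow> bool" where
  "ck_on 0 S h \<longleftrightarrow> continuous_on S h"
| "ck_on (Suc k) S h \<longleftrightarrow> (\<forall>x\<in>S. h differentiable (at x)) \<and>
      (\<forall>v. ck_on k S (\<lambda>x. frechet_derivative h (at x) v))"

definition smooth_on :: "'a::real_normed_vector set \<Rightarrow> ('a \<Rightarrow> 'b::real_normed_vector) \<Rightarrow> bool" where
  "smooth_on S h \<longleftrightarrow> (\<forall>k. ck_on k S h)"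

text \<open>A chart is a pair of its domain and its coordinate map; the latter is only meaningful on the
  domain. The points of the manifold are all elements of the type \<open>'m\<close>, whose topology is the
  manifold topology (Hausdorff and second countable by the type classes); the dimension is
  \<open>CARD('n)\<close>.\<close>

type_synonym ('m, 'n) chart = "'m set \<times> ('m \<Rightarrow> real ^ 'n)"

definition chart_inv :: "('m, 'n::finite) chart \<Rightarrow> real ^ 'n \<Rightarrow> 'm" where
  "chart_inv c = inv_into (fst c) (snd c)"

definition smooth_atlas ::
    "('m::{t2_space, second_countable_topology}, 'n::finite) chart set \<Rightarrow> bool" where
  "smooth_atlas A \<longleftrightarrow>
     (\<forall>c\<in>A. open (fst c) \<and> open (snd c ` fst c) \<and>
        homeomorphism (fst c) (snd c ` fst c) (snd c) (chart_inv c)) \<and>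
     (\<Union>c\<in>A. fst c) = UNIV \<and>
     (\<forall>c\<in>A. \<forall>d\<in>A. smooth_on (snd c ` (fst c \<inter> fst d)) (snd d \<circ> chart_inv c))"


section \<open>Tangent vectors and Riemannian metrics\<close>

text \<open>The tangent space at \<open>x\<close> is represented by \<open>real ^ 'n\<close>: a vector stands for the tangent vector
  having these components in the preferred chart \<open>chart_at A x\<close>. Hence the type \<open>real ^ 'n\<close>
  carries the vector space structure and the topology of each tangent space. The components in any
  other chart are obtained by applying the derivative of the transition map.\<close>

definition chart_at :: "('m, 'n::finite) chart set \<Rightarrow> 'm \<Rightarrow> ('m, 'n) chart" where
  "chart_at A x = (SOME c. c \<in> A \<and> x \<in> fst c)"

definition coord_change ::
    "('m, 'n::finite) chart \<Rightarrow> ('m, 'n) chart \<Rightarrow> 'm \<Rightarrow> real ^ 'n \<Rightarrow> real ^ 'n" where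
  "coord_change c d x = frechet_derivative (snd d \<circ> chart_inv c) (at (snd c x))"

definition components ::
    "('m, 'n::finite) chart set \<Rightarrow> ('m, 'n) chart \<Rightarrow> 'm \<Rightarrow> real ^ 'n \<Rightarrow> real ^ 'n" where
  "components A c x v = coord_change (chart_at A x) c x v"

definition coord_field ::
    "('m, 'n::finite) chart set \<Rightarrow> ('m, 'n) chart \<Rightarrow> 'n \<Rightarrow> 'm \<Rightarrow> real ^ 'n" where
  "coord_field A c i x = coord_change c (chart_at A x) x (axis i 1)"

definition metric_matrix ::
    "('m, 'n::finite) chart set \<Rightarrow> ('m \<Rightarrow> real ^ 'n \<Rightarrow> real ^ 'n \<Rightarrow> real) \<Rightarrow> ('m, 'n) chart
      \<Rightarrow> real ^ 'n \<Rightarrow> real ^ 'n ^ 'n" where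
  "metric_matrix A g c p = (\<chi> i j. g (chart_inv c p)
      (coord_field A c i (chart_inv c p)) (coord_field A c j (chart_inv c p)))"

definition riemannian_metric ::
    "('m, 'n::finite) chart set \<Rightarrow> ('m \<Rightarrow> real ^ 'n \<Rightarrow> real ^ 'n \<Rightarrow> real) \<Rightarrow> bool" where
  "riemannian_metric A g \<longleftrightarrow>
     (\<forall>x. bilinear (g x) \<and> (\<forall>v w. g x v w = g x w v) \<and> (\<forall>v. v \<noteq> 0 \<longrightarrow> g x v v > 0)) \<and>
     (\<forall>c\<in>A. smooth_on (snd c ` fst c) (metric_matrix A g c))"

definition riemannian_manifold ::
    "('m::{t2_space, second_countable_topology}, 'n::finite) chart set
      \<Rightarrow> ('m \<Rightarrow> real ^ 'n \<Rightarrow> real ^ 'n \<Rightarrow> real) \<Rightarrow> bool" where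
  "riemannian_manifold A g \<longleftrightarrow> smooth_atlas A \<and> riemannian_metric A g"

definition g_norm :: "('m \<Rightarrow> real ^ 'n \<Rightarrow> real ^ 'n \<Rightarrow> real) \<Rightarrow> 'm \<Rightarrow> real ^ 'n \<Rightarrow> real" where
  "g_norm g x v = sqrt (g x v v)"


section \<open>Curves, length and Riemannian distance\<close>

text \<open>All curves are parametrized on \<open>{0..1}\<close>; their values elsewhere are irrelevant.\<close>

definition c1_curve_on ::
    "('m::topological_space, 'n::finite) chart set \<Rightarrow> real \<Rightarrow> real \<Rightarrow> (real \<Rightarrow> 'm) \<Rightarrow> bool" where
  "c1_curve_on A a b \<gamma> \<longleftrightarrow> continuous_on {a..b} \<gamma> \<and>
     (\<forall>c\<in>A. \<forall>s\<in>{a..b}. \<gamma> s \<in> fst c \<longrightarrow>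
        (snd c \<circ> \<gamma>) differentiable (at s within {a..b}) \<and>
        continuous (at s within {a..b})
          (\<lambda>r. vector_derivative (snd c \<circ> \<gamma>) (at r within {a..b})))"

text \<open>\<open>S\<close> is the set of break points; \<open>a\<close> and \<open>b\<close> range over consecutive ones.\<close>

definition piecewise_c1_curve ::
    "('m::topological_space, 'n::finite) chart set \<Rightarrow> (real \<Rightarrow> 'm) \<Rightarrow> bool" where
  "piecewise_c1_curve A \<gamma> \<longleftrightarrow>
     (\<exists>S. finite S \<and> {0, 1} \<subseteq> S \<and> S \<subseteq> {0..1} \<and>
        (\<forall>a\<in>S. \<forall>b\<in>S. a < b \<and> S \<inter> {a<..<b} = {} \<longrightarrow> c1_curve_on A a b \<gamma>))"

definition velocity ::
    "('m, 'n::finite) chart set \<Rightarrow> (real \<Rightarrow> 'm) \<Rightarrow> real \<Rightarrow> real ^ 'n" where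
  "velocity A \<gamma> s = vector_derivative (snd (chart_at A (\<gamma> s)) \<circ> \<gamma>) (at s within {0..1})"

definition curve_length ::
    "('m, 'n::finite) chart set \<Rightarrow> ('m \<Rightarrow> real ^ 'n \<Rightarrow> real ^ 'n \<Rightarrow> real) \<Rightarrow> (real \<Rightarrow> 'm) \<Rightarrow> real" where
  "curve_length A g \<gamma> = integral {0..1} (\<lambda>s. g_norm g (\<gamma> s) (velocity A \<gamma> s))"

text \<open>The distance is extended-real valued, being \<open>\<infinity>\<close> exactly between points of different connected
  components, so that connectedness need not be assumed.\<close>

definition rdist ::
    "('m::topological_space, 'n::finite) chart set \<Rightarrow> ('m \<Rightarrow> real ^ 'n \<Rightarrow> real ^ 'n \<Rightarrow> real)
      \<Rightarrow> 'm \<Rightarrow> 'm \<Rightarrow> ereal" where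
  "rdist A g x y =
     Inf {ereal (curve_length A g \<gamma>) |\<gamma>. piecewise_c1_curve A \<gamma> \<and> \<gamma> 0 = x \<and> \<gamma> 1 = y}"

definition complete_riemannian ::
    "('m::topological_space, 'n::finite) chart set \<Rightarrow> ('m \<Rightarrow> real ^ 'n \<Rightarrow> real ^ 'n \<Rightarrow> real)
      \<Rightarrow> bool" where
  "complete_riemannian A g \<longleftrightarrow>
     (\<forall>X :: nat \<Rightarrow> 'm.
        (\<forall>e>0. \<exists>N. \<forall>m\<ge>N. \<forall>n\<ge>N. rdist A g (X m) (X n) < ereal e) \<longrightarrow>
        (\<exists>x. (\<lambda>n. rdist A g (X n) x) \<longlonglongrightarrow> 0))"


section \<open>Levi-Civita connection, geodesics and parallel translation\<close>

text \<open>\<open>christoffel A g c p i j k\<close> is the coefficient \<open>\<Gamma>\<^sup>k\<^sub>i\<^sub>j\<close> of the Levi-Civita connection in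
  the chart \<open>c\<close>: half the sum over \<open>l\<close> of
  \<open>g\<^sup>k\<^sup>l (\<partial>\<^sub>i g\<^sub>j\<^sub>l + \<partial>\<^sub>j g\<^sub>i\<^sub>l - \<partial>\<^sub>l g\<^sub>i\<^sub>j)\<close>.\<close>

definition metric_partial ::
    "('m, 'n::finite) chart set \<Rightarrow> ('m \<Rightarrow> real ^ 'n \<Rightarrow> real ^ 'n \<Rightarrow> real) \<Rightarrow> ('m, 'n) chart
      \<Rightarrow> real ^ 'n \<Rightarrow> 'n \<Rightarrow> 'n \<Rightarrow> 'n \<Rightarrow> real" where
  "metric_partial A g c p i j l =
     frechet_derivative (\<lambda>q. metric_matrix A g c q $ j $ l) (at p) (axis i 1)"

definition christoffel ::
    "('m, 'n::finite) chart set \<Rightarrow> ('m \<Rightarrow> real ^ 'n \<Rightarrow> real ^ 'n \<Rightarrow> real) \<Rightarrow> ('m, 'n) chart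
      \<Rightarrow> real ^ 'n \<Rightarrow> 'n \<Rightarrow> 'n \<Rightarrow> 'n \<Rightarrow> real" where
  "christoffel A g c p i j k =
     (1 / 2) * (\<Sum>l\<in>UNIV. matrix_inv (metric_matrix A g c p) $ k $ l *
        (metric_partial A g c p i j l + metric_partial A g c p j i l - metric_partial A g c p l i j))"

text \<open>\<open>V s\<close> is a tangent vector at \<open>\<gamma> s\<close>. Its covariant derivative along \<open>\<gamma>\<close> vanishes iff, in each
  chart, the components satisfy \<open>V\<^sup>k' = - \<Gamma>\<^sup>k\<^sub>i\<^sub>j \<gamma>\<^sup>i' V\<^sup>j\<close> (summed over \<open>i\<close> and \<open>j\<close>).\<close>

definition parallel_along ::
    "('m, 'n::finite) chart set \<Rightarrow> ('m \<Rightarrow> real ^ 'n \<Rightarrow> real ^ 'n \<Rightarrow> real)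
      \<Rightarrow> (real \<Rightarrow> 'm) \<Rightarrow> (real \<Rightarrow> real ^ 'n) \<Rightarrow> bool" where
  "parallel_along A g \<gamma> V \<longleftrightarrow>
     (\<forall>c\<in>A. \<forall>s\<in>{0..1}. \<gamma> s \<in> fst c \<longrightarrow>
        ((\<lambda>r. components A c (\<gamma> r) (V r)) has_vector_derivative
          (\<chi> k. - (\<Sum>i\<in>UNIV. \<Sum>j\<in>UNIV. christoffel A g c (snd c (\<gamma> s)) i j k
              * (vector_derivative (snd c \<circ> \<gamma>) (at s within {0..1}) $ i)
              * (components A c (\<gamma> s) (V s) $ j))))
        (at s within {0..1}))"

definition geodesic ::
    "('m::topological_space, 'n::finite) chart set \<Rightarrow> ('m \<Rightarrow> real ^ 'n \<Rightarrow> real ^ 'n \<Rightarrow> real)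
      \<Rightarrow> (real \<Rightarrow> 'm) \<Rightarrow> bool" where
  "geodesic A g \<gamma> \<longleftrightarrow> c1_curve_on A 0 1 \<gamma> \<and> parallel_along A g \<gamma> (velocity A \<gamma>)"

definition shortest_geodesic ::
    "('m::topological_space, 'n::finite) chart set \<Rightarrow> ('m \<Rightarrow> real ^ 'n \<Rightarrow> real ^ 'n \<Rightarrow> real)
      \<Rightarrow> 'm \<Rightarrow> 'm \<Rightarrow> (real \<Rightarrow> 'm) \<Rightarrow> bool" where
  "shortest_geodesic A g x y \<gamma> \<longleftrightarrow> geodesic A g \<gamma> \<and> \<gamma> 0 = x \<and> \<gamma> 1 = y \<and>
     ereal (curve_length A g \<gamma>) = rdist A g x y"

text \<open>\<open>L\<^sub>x\<^sub>y\<close>; only meaningful where the shortest geodesic is unique, in particular if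
  \<open>rdist A g x y < inj_radius A g y\<close>.\<close>

definition parallel_transport ::
    "('m::topological_space, 'n::finite) chart set \<Rightarrow> ('m \<Rightarrow> real ^ 'n \<Rightarrow> real ^ 'n \<Rightarrow> real)
      \<Rightarrow> 'm \<Rightarrow> 'm \<Rightarrow> real ^ 'n \<Rightarrow> real ^ 'n" where
  "parallel_transport A g x y v =
     (THE w. \<exists>\<gamma> V. shortest_geodesic A g x y \<gamma> \<and> parallel_along A g \<gamma> V \<and> V 0 = v \<and> V 1 = w)"

definition exp_map ::
    "('m::topological_space, 'n::finite) chart set \<Rightarrow> ('m \<Rightarrow> real ^ 'n \<Rightarrow> real ^ 'n \<Rightarrow> real)
      \<Rightarrow> 'm \<Rightarrow> real ^ 'n \<Rightarrow> 'm" where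
  "exp_map A g x v = (THE y. \<exists>\<gamma>. geodesic A g \<gamma> \<and> \<gamma> 0 = x \<and> velocity A \<gamma> 0 = v \<and> \<gamma> 1 = y)"

definition diffeo_onto_image ::
    "('m::topological_space, 'n::finite) chart set \<Rightarrow> (real ^ 'n) set \<Rightarrow> (real ^ 'n \<Rightarrow> 'm)
      \<Rightarrow> bool" where
  "diffeo_onto_image A B h \<longleftrightarrow>
     open (h ` B) \<and> homeomorphism B (h ` B) h (inv_into B h) \<and>
     (\<forall>c\<in>A. smooth_on {v \<in> B. h v \<in> fst c} (snd c \<circ> h) \<and>
        smooth_on (snd c ` (fst c \<inter> h ` B)) (inv_into B h \<circ> chart_inv c))"

definition inj_radius ::
    "('m::topological_space, 'n::finite) chart set \<Rightarrow> ('m \<Rightarrow> real ^ 'n \<Rightarrow> real ^ 'n \<Rightarrow> real)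
      \<Rightarrow> 'm \<Rightarrow> ereal" where
  "inj_radius A g x =
     Sup {ereal r |r. r > 0 \<and> diffeo_onto_image A {v. g_norm g x v < r} (exp_map A g x)}"


section \<open>The control problem\<close>

definition extended_velocities ::
    "(real \<Rightarrow> 'm \<Rightarrow> 'u \<Rightarrow> real) \<Rightarrow> (real \<Rightarrow> 'm \<Rightarrow> 'u \<Rightarrow> real ^ 'n) \<Rightarrow> (real \<Rightarrow> 'm \<Rightarrow> 'u set)
      \<Rightarrow> real \<Rightarrow> 'm \<Rightarrow> (real \<times> (real ^ 'n)) set" where
  "extended_velocities f0 f \<Gamma> t x =
     {(x0, X). \<exists>u\<in>\<Gamma> t x. x0 \<ge> f0 t x u \<and> X = f t x u}"

definition upper_semicont ::
    "('m::topological_space, 'n::finite) chart set \<Rightarrow> ('m \<Rightarrow> real ^ 'n \<Rightarrow> real ^ 'n \<Rightarrow> real)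
      \<Rightarrow> ('m \<Rightarrow> 'u::topological_space set) \<Rightarrow> bool" where
  "upper_semicont A g G \<longleftrightarrow>
     (\<forall>x Q. G x \<subseteq> interior Q \<longrightarrow>
        (\<exists>\<delta>>0. \<forall>y. rdist A g x y < ereal \<delta> \<longrightarrow> G y \<subseteq> Q))"

definition cond_A3 ::
    "('m::topological_space, 'n::finite) chart set \<Rightarrow> ('m \<Rightarrow> real ^ 'n \<Rightarrow> real ^ 'n \<Rightarrow> real)
      \<Rightarrow> (real \<Rightarrow> 'm \<Rightarrow> 'u::metric_space \<Rightarrow> real) \<Rightarrow> (real \<Rightarrow> 'm \<Rightarrow> 'u \<Rightarrow> real ^ 'n)
      \<Rightarrow> (real \<Rightarrow> 'm \<Rightarrow> 'u set) \<Rightarrow> real \<Rightarrow> bool" where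
  "cond_A3 A g f0 f \<Gamma> t \<longleftrightarrow>
     upper_semicont A g (\<Gamma> t) \<and>
     (\<forall>y. \<forall>\<epsilon>>0. \<exists>\<sigma>>0. ereal \<sigma> < inj_radius A g y \<and>
        (\<forall>y' u' u. max (rdist A g y y') (ereal (dist u u')) < ereal \<sigma> \<longrightarrow>
           g_norm g y (parallel_transport A g y' y (f t y' u') - f t y u) < \<epsilon> \<and>
           f0 t y' u' > f0 t y u - \<epsilon>))"

definition cond_A4 ::
    "('m::topological_space, 'n::finite) chart set \<Rightarrow> ('m \<Rightarrow> real ^ 'n \<Rightarrow> real ^ 'n \<Rightarrow> real)
      \<Rightarrow> (real \<Rightarrow> 'm \<Rightarrow> 'u::metric_space \<Rightarrow> real) \<Rightarrow> (real \<Rightarrow> 'm \<Rightarrow> 'u \<Rightarrow> real ^ 'n)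
      \<Rightarrow> (real \<Rightarrow> 'm \<Rightarrow> 'u set) \<Rightarrow> real \<Rightarrow> bool" where
  "cond_A4 A g f0 f \<Gamma> t \<longleftrightarrow>
     (\<exists>G. \<forall>x. \<Gamma> t x = G) \<and>
     (\<forall>y. \<forall>\<epsilon>>0. \<exists>\<sigma>>0. ereal \<sigma> < inj_radius A g y \<and>
        (\<forall>y' u. rdist A g y y' < ereal \<sigma> \<longrightarrow>
           g_norm g y (parallel_transport A g y' y (f t y' u) - f t y u) < \<epsilon> \<and>
           f0 t y' u > f0 t y u - \<epsilon>))"

definition transport_set ::
    "('m::topological_space, 'n::finite) chart set \<Rightarrow> ('m \<Rightarrow> real ^ 'n \<Rightarrow> real ^ 'n \<Rightarrow> real)
      \<Rightarrow> 'm \<Rightarrow> 'm \<Rightarrow> (real \<times> (real ^ 'n)) set \<Rightarrow> (real \<times> (real ^ 'n)) set" where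
  "transport_set A g x y S = {(x0, parallel_transport A g x y X) |x0 X. (x0, X) \<in> S}"

definition cesari_type ::
    "('m::topological_space, 'n::finite) chart set \<Rightarrow> ('m \<Rightarrow> real ^ 'n \<Rightarrow> real ^ 'n \<Rightarrow> real)
      \<Rightarrow> ('m \<Rightarrow> (real \<times> (real ^ 'n)) set) \<Rightarrow> bool" where
  "cesari_type A g E \<longleftrightarrow>
     (\<forall>x. (\<Inter>\<delta>\<in>{\<delta>. 0 < \<delta> \<and> ereal \<delta> < inj_radius A g x}.
        closure (convex hull (\<Union>y\<in>{y. rdist A g y x < ereal \<delta>}. transport_set A g y x (E y)))) = E x)"

end

theory Submission
  imports Defs
begin

text \<open>If the Cesari-type property holds, each value is an intersection of closed convex sets.
  Conversely, the semicontinuity conditions put every transported set \<open>L\<^sub>y\<^sub>x E(y)\<close> with \<open>y\<close>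
  near \<open>x\<close> inside \<open>E(x) + B\<close>, where \<open>B\<close> is a small closed ball. Since \<open>E(x)\<close> is closed and
  convex, so is \<open>E(x) + B\<close>, which therefore contains the closed convex hull of the union; letting
  the ball shrink gives one inclusion. For the other one, the conditions taken at coinciding points
  force \<open>L\<^sub>x\<^sub>x\<close> to fix all the vectors \<open>f(t,x,u)\<close>, so that no theory of parallel translation is
  needed. The only geometric facts used are that \<open>\<rho>\<close> is symmetric and vanishes on the diagonal.\<close>

section \<open>The Riemannian distance\<close>

lemma has_vector_derivative_reflect:
  assumes "(h has_vector_derivative D) (at (1 - r) within {a..b})"
  shows "((\<lambda>s. h (1 - s)) has_vector_derivative - D) (at r within {1 - b..1 - a::real})"
proof -
  have "((\<lambda>s. 1 - s) has_vector_derivative - 1) (at r within {1 - b..1 - a})"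
    by (auto intro!: derivative_eq_intros)
  moreover have "(\<lambda>s. 1 - s) ` {1 - b..1 - a} = {a..b}"
    by simp
  ultimately show ?thesis
    using vector_diff_chain_within[of "\<lambda>s. 1 - s" "- 1" r "{1 - b..1 - a}" h D] assms
    by (simp add: o_def)
qed

lemma vector_derivative_reflect:
  fixes h :: "real \<Rightarrow> 'a::euclidean_space"
  assumes "h differentiable (at (1 - r) within {a..b})" "r \<in> {1 - b..1 - a}" "a < b"
  shows "vector_derivative (\<lambda>s. h (1 - s)) (at r within {1 - b..1 - a::real})
      = - vector_derivative h (at (1 - r) within {a..b})"
  using assms
  by (intro vector_derivative_within_closed_interval has_vector_derivative_reflect)
    (auto simp: vector_derivative_works)

lemma has_integral_reflect_unit:
  fixes h :: "real \<Rightarrow> real"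
  assumes "(h has_integral I) {0..1}"
  shows "((\<lambda>s. h (1 - s)) has_integral I) {0..1}"
  using has_integral_affinity[of h I 0 1 "- 1" 1] assms by simp

text \<open>Reflection is an involution, so one implication already makes both functions have the
  same integrals. The two sides therefore agree also in the non-integrable case, where
  \<open>integral\<close> takes its default value; this matters because lengths are compared below
  without knowing that the speed is integrable.\<close>

lemma integral_reflect_unit:
  fixes h :: "real \<Rightarrow> real"
  shows "integral {0..1} (\<lambda>s. h (1 - s)) = integral {0..1} h"
proof -
  have "((\<lambda>s. h (1 - s)) has_integral I) {0..1} \<longleftrightarrow> (h has_integral I) {0..1}" for I
    using has_integral_reflect_unit[of h I] has_integral_reflect_unit[of "\<lambda>s. h (1 - s)" I]
    by auto
  then show ?thesis
    unfolding integral_def integrable_on_def by simp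
qed

lemma c1_curve_on_reflect:
  assumes charts: "\<And>c. c \<in> A \<Longrightarrow> open (fst c)"
    and "a < b" and c1: "c1_curve_on A a b \<gamma>"
  shows "c1_curve_on A (1 - b) (1 - a) (\<lambda>s. \<gamma> (1 - s))"
  unfolding c1_curve_on_def
proof (intro conjI ballI impI)
  have cont: "continuous_on {a..b} \<gamma>"
    using c1 by (simp add: c1_curve_on_def)
  show cont': "continuous_on {1 - b..1 - a} (\<lambda>s. \<gamma> (1 - s))"
    by (rule continuous_on_compose2[OF cont]) (auto intro!: continuous_intros)
  fix c s
  assume c: "c \<in> A" and s: "s \<in> {1 - b..1 - a}" and dom: "\<gamma> (1 - s) \<in> fst c"
  let ?h = "snd c \<circ> \<gamma>"
  have comp: "snd c \<circ> (\<lambda>s. \<gamma> (1 - s)) = (\<lambda>s. ?h (1 - s))"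
    by auto
  have diff: "?h differentiable (at (1 - r) within {a..b})"
    if "r \<in> {1 - b..1 - a}" "\<gamma> (1 - r) \<in> fst c" for r
    using c1 c that by (auto simp: c1_curve_on_def)
  show "(snd c \<circ> (\<lambda>s. \<gamma> (1 - s))) differentiable (at s within {1 - b..1 - a})"
    unfolding comp using diff[OF s dom] has_vector_derivative_reflect[of ?h _ s a b]
    by (metis vector_derivative_works differentiableI_vector)
  have "continuous (at (1 - s) within {a..b}) (\<lambda>r. vector_derivative ?h (at r within {a..b}))"
    using c1 c s dom by (auto simp: c1_curve_on_def)
  moreover have "(\<lambda>s. 1 - s) ` {1 - b..1 - a} = {a..b}"
    by simp
  ultimately have "continuous (at s within {1 - b..1 - a})
      (\<lambda>r. - vector_derivative ?h (at (1 - r) within {a..b}))"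
    by (intro continuous_minus
          continuous_within_compose2[where f = "\<lambda>s. 1 - s" and g = "\<lambda>r. vector_derivative ?h (at r within {a..b})"])
      (simp_all add: continuous_diff)
  \<comment> \<open>The derivative of the reflected curve is known only at parameters whose point
    lies in the chart. Since the chart domain is open, these form a relatively open neighborhood of
    \<open>s\<close>, which suffices for continuity at \<open>s\<close>.\<close>
  moreover have "openin (top_of_set {1 - b..1 - a})
      ({1 - b..1 - a} \<inter> (\<lambda>s. \<gamma> (1 - s)) -` fst c)"
    using cont' charts[OF c] by (rule continuous_openin_preimage_gen)
  ultimately show "continuous (at s within {1 - b..1 - a})
      (\<lambda>r. vector_derivative (snd c \<circ> (\<lambda>s. \<gamma> (1 - s))) (at r within {1 - b..1 - a}))"
    unfolding comp
    by (rule continuous_transform_within_openin)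
      (use s dom diff \<open>a < b\<close> in \<open>auto simp: vector_derivative_reflect simp del: o_apply\<close>)
qed

lemma piecewise_c1_curve_reflect:
  assumes charts: "\<And>c. c \<in> A \<Longrightarrow> open (fst c)" and "piecewise_c1_curve A \<gamma>"
  shows "piecewise_c1_curve A (\<lambda>s. \<gamma> (1 - s))"
proof -
  obtain S where S: "finite S" "{0, 1} \<subseteq> S" "S \<subseteq> {0..1}"
    and c1: "\<forall>a\<in>S. \<forall>b\<in>S. a < b \<and> S \<inter> {a<..<b} = {} \<longrightarrow> c1_curve_on A a b \<gamma>"
    using assms(2) unfolding piecewise_c1_curve_def by blast
  let ?S = "(\<lambda>s. 1 - s) ` S"
  have "c1_curve_on A a b (\<lambda>s. \<gamma> (1 - s))"
    if "a \<in> ?S" "b \<in> ?S" "a < b" "?S \<inter> {a<..<b} = {}" for a b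
  proof -
    have "1 - s \<notin> {a<..<b}" if "s \<in> S" for s
      using \<open>?S \<inter> {a<..<b} = {}\<close> that by blast
    then have "S \<inter> {1 - b<..<1 - a} = {}"
      by fastforce
    moreover have "1 - a \<in> S" "1 - b \<in> S"
      using that by auto
    ultimately have "c1_curve_on A (1 - b) (1 - a) \<gamma>"
      using c1 \<open>a < b\<close> by simp
    then show ?thesis
      using c1_curve_on_reflect[OF charts, where a = "1 - b" and b = "1 - a"] \<open>a < b\<close> by simp
  qed
  moreover have "finite ?S" "{0, 1} \<subseteq> ?S" "?S \<subseteq> {0..1}"
    using S by (auto simp: image_iff intro: bexI[of _ 0] bexI[of _ 1])
  ultimately show ?thesis
    unfolding piecewise_c1_curve_def
    by (intro exI[of _ ?S] conjI ballI impI) simp_all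
qed

text \<open>\<open>velocity\<close> differentiates within \<open>{0..1}\<close>, while smoothness is
  given only within each piece. The two notions agree at interior points of a piece, so only the
  finitely many break points have to be excluded.\<close>

lemma piecewise_c1_curve_differentiable:
  assumes "piecewise_c1_curve A \<gamma>"
  shows "\<exists>S. finite S \<and> (\<forall>s\<in>{0..1} - S. \<forall>c\<in>A. \<gamma> s \<in> fst c \<longrightarrow>
    (snd c \<circ> \<gamma>) differentiable (at s within {0..1}))"
proof -
  obtain S where S: "finite S" "{0, 1} \<subseteq> S"
    and c1: "\<forall>a\<in>S. \<forall>b\<in>S. a < b \<and> S \<inter> {a<..<b} = {} \<longrightarrow> c1_curve_on A a b \<gamma>"
    using assms unfolding piecewise_c1_curve_def by blast
  have "(snd c \<circ> \<gamma>) differentiable (at s within {0..1})"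
    if s: "s \<in> {0..1} - S" and c: "c \<in> A" "\<gamma> s \<in> fst c" for s c
  proof -
    have s01: "0 < s" "s < 1"
      using s S(2) by (auto simp: less_le)
    \<comment> \<open>The break points adjacent to \<open>s\<close> are consecutive; they exist
      because 0 and 1 are break points.\<close>
    define a where "a = Max {r \<in> S. r < s}"
    define b where "b = Min {r \<in> S. s < r}"
    have a: "a \<in> {r \<in> S. r < s}" unfolding a_def
      using S s01 by (intro Max_in) auto
    have b: "b \<in> {r \<in> S. s < r}" unfolding b_def
      using S s01 by (intro Min_in) auto
    have "r \<le> a \<or> b \<le> r" if "r \<in> S" for r
      using that s S(1) unfolding a_def b_def by (cases r s rule: linorder_cases) auto
    then have "S \<inter> {a<..<b} = {}"
      by fastforce
    then have "c1_curve_on A a b \<gamma>"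
      using c1 a b by simp
    then have "(snd c \<circ> \<gamma>) differentiable (at s within {a..b})"
      using a b c by (simp add: c1_curve_on_def)
    then show ?thesis
      using a b s01 by (simp add: at_within_Icc_at)
  qed
  with S(1) show ?thesis
    by blast
qed

text \<open>Reversal changes the sign of the velocity, which \<open>g_norm\<close> does not see. The
  chart in \<open>velocity\<close> depends on the point alone, so both curves are differentiated in
  the same chart. The reflected break points form a finite set, negligible for the integral.\<close>

lemma curve_length_reflect:
  assumes atlas: "(\<Union>c\<in>A. fst c) = UNIV" and bil: "\<And>x. bilinear (g x)"
    and pw: "piecewise_c1_curve A \<gamma>"
  shows "curve_length A g (\<lambda>s. \<gamma> (1 - s)) = curve_length A g \<gamma>"
proof -
  obtain S where S: "finite S"
    and diff: "\<forall>s\<in>{0..1} - S. \<forall>c\<in>A. \<gamma> s \<in> fst c \<longrightarrow>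
      (snd c \<circ> \<gamma>) differentiable (at s within {0..1})"
    using piecewise_c1_curve_differentiable[OF pw] by blast
  have chart: "chart_at A x \<in> A \<and> x \<in> fst (chart_at A x)" for x
    unfolding chart_at_def by (rule someI_ex) (use atlas in blast)
  have "velocity A (\<lambda>s. \<gamma> (1 - s)) s = - velocity A \<gamma> (1 - s)"
    if s: "s \<in> {0..1}" "s \<notin> (\<lambda>s. 1 - s) ` S" for s
  proof -
    let ?h = "snd (chart_at A (\<gamma> (1 - s))) \<circ> \<gamma>"
    have "1 - s \<in> {0..1} - S"
      using s by (auto simp: image_iff)
    then have "?h differentiable (at (1 - s) within {0..1})"
      using diff chart by blast
    from vector_derivative_reflect[OF this] show ?thesis
      using s(1) by (simp add: velocity_def o_def)
  qed
  then have "curve_length A g (\<lambda>s. \<gamma> (1 - s))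
      = integral {0..1} (\<lambda>s. g_norm g (\<gamma> (1 - s)) (velocity A \<gamma> (1 - s)))"
    unfolding curve_length_def using S
    by (intro integral_spike[of "(\<lambda>s. 1 - s) ` S"])
      (auto simp: g_norm_def bilinear_lneg bilinear_rneg bil)
  then show ?thesis
    unfolding curve_length_def
    using integral_reflect_unit[of "\<lambda>s. g_norm g (\<gamma> s) (velocity A \<gamma> s)"] by simp
qed

text \<open>Reversal turns each curve competing for one infimum into one of equal length competing
  for the other. Symmetry links the conditions, which measure from the base point, to
  \<open>cesari_type\<close>, which measures towards it.\<close>

lemma rdist_commute:
  assumes "riemannian_manifold A g"
  shows "rdist A g x y = rdist A g y x"
proof -
  have charts: "open (fst c)" if "c \<in> A" for c
    using assms that by (auto simp: riemannian_manifold_def smooth_atlas_def)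
  have cover: "(\<Union>c\<in>A. fst c) = UNIV"
    using assms by (auto simp: riemannian_manifold_def smooth_atlas_def)
  have le: "rdist A g x y \<le> rdist A g y x" for x y
    unfolding rdist_def
  proof (rule Inf_greatest, clarify)
    fix \<gamma>
    assume \<gamma>: "piecewise_c1_curve A \<gamma>" "y = \<gamma> 0" "x = \<gamma> 1"
    have "piecewise_c1_curve A (\<lambda>s. \<gamma> (1 - s))"
      using charts \<gamma>(1) by (intro piecewise_c1_curve_reflect)
    moreover have "curve_length A g (\<lambda>s. \<gamma> (1 - s)) = curve_length A g \<gamma>"
      using assms \<gamma>(1) cover
      by (intro curve_length_reflect)
        (auto simp: riemannian_manifold_def riemannian_metric_def)
    ultimately show "Inf {ereal (curve_length A g \<gamma>') |\<gamma>'.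
        piecewise_c1_curve A \<gamma>' \<and> \<gamma>' 0 = \<gamma> 1 \<and> \<gamma>' 1 = \<gamma> 0} \<le> ereal (curve_length A g \<gamma>)"
      by (intro Inf_lower CollectI exI[of _ "\<lambda>s. \<gamma> (1 - s)"]) simp
  qed
  show ?thesis
    by (intro antisym le)
qed

text \<open>The constant curve has length 0. The upper bound puts each point into every ball of
  positive radius about itself.\<close>

lemma rdist_refl_le:
  assumes "\<And>x. bilinear (g x)"
  shows "rdist A g x x \<le> 0"
proof -
  \<comment> \<open>On a nondegenerate interval the derivative is unique, so
    \<open>vector_derivative\<close> is not an arbitrary choice.\<close>
  have deriv: "vector_derivative (\<lambda>_. v) (at r within {a..b}) = 0"
    if "a < b" "r \<in> {a..b}" for v :: "real ^ 'b" and a b r :: real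
    using that by (intro vector_derivative_within_closed_interval) auto
  have "c1_curve_on A a b (\<lambda>_. x)" if "a < b" for a b
    unfolding c1_curve_on_def o_def
  proof (intro conjI ballI impI)
    fix c :: "('a, 'b) chart" and s
    assume "s \<in> {a..b}"
    then show "continuous (at s within {a..b})
        (\<lambda>r. vector_derivative (\<lambda>_. snd c x) (at r within {a..b}))"
      using deriv[OF that]
      by (intro continuous_transform_within[OF continuous_const[of _ 0], of 1]) auto
  qed auto
  then have "piecewise_c1_curve A (\<lambda>_. x)"
    unfolding piecewise_c1_curve_def by (intro exI[of _ "{0, 1}"]) auto
  moreover have "curve_length A g (\<lambda>_. x) = integral {0..1::real} (\<lambda>_. 0)"
    unfolding curve_length_def
    by (intro Henstock_Kurzweil_Integration.integral_cong) (simp add: velocity_def o_def deriv g_norm_def bilinear_lzero assms)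
  ultimately show ?thesis
    unfolding rdist_def
    by (intro Inf_lower CollectI exI[of _ "\<lambda>_. x"]) (simp add: zero_ereal_def)
qed

text \<open>By compactness \<open>g_norm\<close> has a positive minimum on the Euclidean unit
  sphere, and homogeneity carries the bound to all vectors. This turns estimates in the Riemannian
  norm into estimates in the topology in which closures are taken.\<close>

lemma norm_le_g_norm:
  assumes "bilinear (g x)" and pos: "\<And>v. v \<noteq> 0 \<Longrightarrow> g x v v > 0"
  shows "\<exists>C>0. \<forall>v :: real ^ 'n::finite. norm v \<le> C * g_norm g x v"
proof -
  have "continuous_on (sphere 0 1) (\<lambda>v. g_norm g x v)"
    unfolding g_norm_def
    using bilinear_continuous_on_compose[OF continuous_on_id continuous_on_id assms(1)]
    by (rule continuous_on_real_sqrt)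
  moreover have "sphere (0 :: real ^ 'n) 1 \<noteq> {}"
    by simp
  ultimately obtain w where w: "w \<in> sphere 0 1"
    "\<And>v. v \<in> sphere 0 1 \<Longrightarrow> g_norm g x w \<le> g_norm g x v"
    using continuous_attains_inf[OF compact_sphere] by blast
  have m: "g_norm g x w > 0"
    using pos[of w] w(1) by (cases "w = 0") (auto simp: g_norm_def)
  have "norm v \<le> 1 / g_norm g x w * g_norm g x v" for v
  proof (cases "v = 0")
    case False
    have "g_norm g x v = norm v * g_norm g x (v /\<^sub>R norm v)"
      using False
      by (simp add: g_norm_def bilinear_lmul[OF assms(1)] bilinear_rmul[OF assms(1)]
          real_sqrt_mult real_sqrt_divide field_simps)
    moreover have "g_norm g x w \<le> g_norm g x (v /\<^sub>R norm v)"
      using False by (intro w(2)) simp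
    ultimately have "norm v * g_norm g x w \<le> g_norm g x v"
      by (simp add: mult_left_mono)
    then show ?thesis
      using m by (simp add: field_simps)
  qed (use assms in \<open>simp add: g_norm_def bilinear_lzero\<close>)
  with m show ?thesis
    by (intro exI[of _ "1 / g_norm g x w"]) simp
qed

section \<open>The Cesari-type property\<close>

lemma convex_closed_if_cesari_type:
  assumes "cesari_type A g E"
  shows "convex (E x) \<and> closed (E x)"
proof -
  let ?C = "\<lambda>\<delta>. closure (convex hull (\<Union>y\<in>{y. rdist A g y x < ereal \<delta>}. transport_set A g y x (E y)))"
  have E: "E x = (\<Inter>\<delta>\<in>{\<delta>. 0 < \<delta> \<and> ereal \<delta> < inj_radius A g x}. ?C \<delta>)"
    using assms unfolding cesari_type_def by blast
  \<comment> \<open>Were there no admissible \<open>\<delta>\<close>, the intersection would be the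
    whole space, which is convex and closed too.\<close>
  show ?thesis
    unfolding E by (intro conjI convex_INT closed_INT ballI convex_closure) auto
qed

text \<open>The union is the Minkowski sum of \<open>E\<close> and a closed ball. It is convex as a
  sum of convex sets, and closed because the ball is compact.\<close>

lemma closure_hull_subset_thickening:
  fixes E :: "'a::euclidean_space set"
  assumes "convex E" "closed E" "S \<subseteq> (\<Union>e\<in>E. \<Union>b\<in>cball 0 \<eta>. {e + b})"
  shows "closure (convex hull S) \<subseteq> (\<Union>e\<in>E. \<Union>b\<in>cball 0 \<eta>. {e + b})"
proof -
  have "closed (\<Union>e\<in>E. \<Union>b\<in>cball 0 \<eta>. {e + b})"
    using assms by (intro closed_compact_sums) auto
  moreover have "convex (\<Union>e\<in>E. \<Union>b\<in>cball 0 \<eta>. {e + b})"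
    using assms by (intro convex_sums) auto
  ultimately show ?thesis
    using assms(3) by (intro closure_minimal hull_minimal)
qed

text \<open>\<open>near\<close> is the common content of (A3') and (A4'): each control at a nearby
  point is matched by some control at \<open>x\<close>. \<open>fixed\<close> is what they say at
  coinciding points.\<close>

lemma cesari_type_extended_velocities:
  assumes M: "riemannian_manifold A g"
    and near: "\<And>x \<epsilon>. \<epsilon> > 0 \<Longrightarrow> \<exists>\<delta>>0. ereal \<delta> < inj_radius A g x \<and>
      (\<forall>y. rdist A g x y < ereal \<delta> \<longrightarrow> (\<forall>u\<in>\<Gamma> t y. \<exists>v\<in>\<Gamma> t x.
        g_norm g x (parallel_transport A g y x (f t y u) - f t x v) < \<epsilon> \<and>
        f0 t y u > f0 t x v - \<epsilon>))"
    and fixed: "\<And>x u \<epsilon>. \<epsilon> > 0 \<Longrightarrow>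
      g_norm g x (parallel_transport A g x x (f t x u) - f t x u) < \<epsilon>"
    and cc: "\<And>x. convex (extended_velocities f0 f \<Gamma> t x)"
      "\<And>x. closed (extended_velocities f0 f \<Gamma> t x)"
  shows "cesari_type A g (extended_velocities f0 f \<Gamma> t)"
proof -
  let ?E = "extended_velocities f0 f \<Gamma> t"
  have bil: "bilinear (g x)" and pos: "v \<noteq> 0 \<Longrightarrow> g x v v > 0" for x v
    using M by (auto simp: riemannian_manifold_def riemannian_metric_def)
  define U where "U = (\<lambda>x \<delta>. \<Union>y\<in>{y. rdist A g y x < ereal \<delta>}. transport_set A g y x (?E y))"
  have "(\<Inter>\<delta>\<in>{\<delta>. 0 < \<delta> \<and> ereal \<delta> < inj_radius A g x}. closure (convex hull (U x \<delta>))) = ?E x" for x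
  proof
    have "?E x \<subseteq> U x \<delta>" if "\<delta> > 0" for \<delta>
    proof -
      obtain C where C: "C > 0" "\<And>v. norm v \<le> C * g_norm g x v"
        using norm_le_g_norm[of g x, OF bil pos] by blast
      \<comment> \<open>The deviation is below every positive number in the Riemannian norm, hence
        zero. So \<open>?E x\<close> itself contributes to the union through
        \<open>y = x\<close>.\<close>
      have "parallel_transport A g x x (f t x u) = f t x u" for u
      proof -
        have "g_norm g x (parallel_transport A g x x (f t x u) - f t x u) \<le> 0"
          by (rule field_le_epsilon) (simp add: fixed less_imp_le)
        then have "C * g_norm g x (parallel_transport A g x x (f t x u) - f t x u) \<le> 0"
          using C(1) by (simp add: mult_le_0_iff)
        then have "norm (parallel_transport A g x x (f t x u) - f t x u) \<le> 0"
          using C(2) order_trans by blast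
        then show ?thesis
          by simp
      qed
      then have "?E x \<subseteq> transport_set A g x x (?E x)"
        unfolding transport_set_def extended_velocities_def by auto metis
      moreover have "rdist A g x x < ereal \<delta>"
        using rdist_refl_le[of g A x] bil that by (simp add: le_less_trans)
      ultimately show ?thesis
        unfolding U_def by blast
    qed
    then show "?E x \<subseteq> (\<Inter>\<delta>\<in>{\<delta>. 0 < \<delta> \<and> ereal \<delta> < inj_radius A g x}. closure (convex hull (U x \<delta>)))"
      using closure_subset hull_subset by (fast dest: subsetD)
  next
    show "(\<Inter>\<delta>\<in>{\<delta>. 0 < \<delta> \<and> ereal \<delta> < inj_radius A g x}. closure (convex hull (U x \<delta>))) \<subseteq> ?E x"
    proof
      fix z
      assume z: "z \<in> (\<Inter>\<delta>\<in>{\<delta>. 0 < \<delta> \<and> ereal \<delta> < inj_radius A g x}. closure (convex hull (U x \<delta>)))"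
      obtain C where C: "C > 0" "\<And>v. norm v \<le> C * g_norm g x v"
        using norm_le_g_norm[of g x, OF bil pos] by blast
      have "\<exists>e\<in>?E x. dist e z < \<eta>" if "\<eta> > 0" for \<eta>
      proof -
        \<comment> \<open>The first coordinate will be off by \<open>\<epsilon>\<close> and the
          vector part by at most \<open>C * \<epsilon>\<close>; this choice makes the total
          \<open>\<eta> / 2\<close>.\<close>
        define \<epsilon> where "\<epsilon> = \<eta> / (2 * (1 + C))"
        have "\<epsilon> > 0"
          using \<open>\<eta> > 0\<close> C(1) by (simp add: \<epsilon>_def)
        then obtain \<delta> where \<delta>: "\<delta> > 0" "ereal \<delta> < inj_radius A g x"
          and *: "\<And>y u. \<lbrakk>rdist A g x y < ereal \<delta>; u \<in> \<Gamma> t y\<rbrakk> \<Longrightarrow> \<exists>v\<in>\<Gamma> t x.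
            g_norm g x (parallel_transport A g y x (f t y u) - f t x v) < \<epsilon> \<and>
            f0 t y u > f0 t x v - \<epsilon>"
          using near[OF \<open>\<epsilon> > 0\<close>, of x] by blast
        have "U x \<delta> \<subseteq> (\<Union>e\<in>?E x. \<Union>b\<in>cball 0 (\<epsilon> + C * \<epsilon>). {e + b})"
        proof
          fix p
          assume "p \<in> U x \<delta>"
          then obtain y u p0 where y: "rdist A g x y < ereal \<delta>" and u: "u \<in> \<Gamma> t y" "p0 \<ge> f0 t y u"
            and p: "p = (p0, parallel_transport A g y x (f t y u))"
            unfolding U_def transport_set_def extended_velocities_def
            by (auto simp: rdist_commute[OF M, of _ x])
          obtain v where v: "v \<in> \<Gamma> t x"
            "g_norm g x (parallel_transport A g y x (f t y u) - f t x v) < \<epsilon>"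
            "f0 t y u > f0 t x v - \<epsilon>"
            using *[OF y u(1)] by blast
          \<comment> \<open>Here \<open>p0 \<ge> f0 t y u > f0 t x v - \<epsilon>\<close>, so
            raising \<open>p0\<close> by \<open>\<epsilon>\<close> lands above
            \<open>f0 t x v\<close>. Since the first coordinate is free upwards, the one-sided bound
            on \<open>f0\<close> is enough.\<close>
          let ?e = "(p0 + \<epsilon>, f t x v)"
          have "?e \<in> ?E x"
            using u v by (force simp: extended_velocities_def)
          moreover have "norm (parallel_transport A g y x (f t y u) - f t x v) \<le> C * \<epsilon>"
            using C(2) v(2) C(1) by (meson less_imp_le mult_left_mono order_trans)
          then have "norm (p - ?e) \<le> \<epsilon> + C * \<epsilon>"
            using \<open>\<epsilon> > 0\<close> norm_Pair_le[of "- \<epsilon>" "parallel_transport A g y x (f t y u) - f t x v"]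
            by (simp add: p)
          moreover have "p = ?e + (p - ?e)"
            by simp
          ultimately show "p \<in> (\<Union>e\<in>?E x. \<Union>b\<in>cball 0 (\<epsilon> + C * \<epsilon>). {e + b})"
            by (metis (no_types, lifting) UN_I mem_cball_0 singletonI)
        qed
        then have "closure (convex hull (U x \<delta>)) \<subseteq>
            (\<Union>e\<in>?E x. \<Union>b\<in>cball 0 (\<epsilon> + C * \<epsilon>). {e + b})"
          by (rule closure_hull_subset_thickening[OF cc])
        moreover have "z \<in> closure (convex hull (U x \<delta>))"
          using z \<delta> by simp
        ultimately obtain e b where e: "e \<in> ?E x" "norm b \<le> \<epsilon> + C * \<epsilon>" "z = e + b"
          by auto
        have "\<epsilon> + C * \<epsilon> = (1 + C) * \<epsilon>"
          by (simp add: algebra_simps)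
        also have "\<dots> = \<eta> / 2"
          using C(1) by (simp add: \<epsilon>_def field_simps)
        finally have "\<epsilon> + C * \<epsilon> < \<eta>"
          using \<open>\<eta> > 0\<close> by simp
        then show ?thesis
          using e by (intro bexI[of _ e]) (auto simp: dist_norm)
      qed
      then show "z \<in> ?E x"
        using cc(2) by (metis closure_approachable closure_closed)
    qed
  qed
  then show ?thesis
    unfolding cesari_type_def U_def by blast
qed

section \<open>Matching controls under (A3') and (A4')\<close>

lemma cesari_type_if_cond_A3:
  assumes M: "riemannian_manifold A g" and A3: "cond_A3 A g f0 f \<Gamma> t"
    and cc: "\<And>x. convex (extended_velocities f0 f \<Gamma> t x)"
      "\<And>x. closed (extended_velocities f0 f \<Gamma> t x)"
  shows "cesari_type A g (extended_velocities f0 f \<Gamma> t)"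
proof (rule cesari_type_extended_velocities[OF M _ _ cc])
  fix x and \<epsilon> :: real
  assume "\<epsilon> > 0"
  then obtain \<sigma> where \<sigma>: "\<sigma> > 0" "ereal \<sigma> < inj_radius A g x"
    and *: "\<And>y u v. \<lbrakk>rdist A g x y < ereal \<sigma>; dist v u < \<sigma>\<rbrakk> \<Longrightarrow>
      g_norm g x (parallel_transport A g y x (f t y u) - f t x v) < \<epsilon> \<and>
      f0 t y u > f0 t x v - \<epsilon>"
    using A3 unfolding cond_A3_def by (metis max_less_iff_conj less_ereal.simps(1))
  \<comment> \<open>Upper semicontinuity for this open neighborhood places every control at a point
    close to \<open>x\<close> within \<open>\<sigma>\<close> of some \<open>v\<close> in
    \<open>\<Gamma> t x\<close>, as the estimate \<open>*\<close> demands. If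
    \<open>\<Gamma> t x\<close> is empty, so is \<open>?Q\<close>, and nearby points have no
    controls.\<close>
  let ?Q = "\<Union>v\<in>\<Gamma> t x. ball v \<sigma>"
  have "\<Gamma> t x \<subseteq> interior ?Q"
    using \<sigma>(1) by (subst interior_open) auto
  then obtain \<delta> where "\<delta> > 0" and \<delta>: "\<And>y. rdist A g x y < ereal \<delta> \<Longrightarrow> \<Gamma> t y \<subseteq> ?Q"
    using A3 unfolding cond_A3_def upper_semicont_def by meson
  have "ereal (min \<sigma> \<delta>) < inj_radius A g x"
    using \<sigma>(2) by (auto simp: min_def intro: le_less_trans[of _ "ereal \<sigma>"])
  moreover have "\<exists>v\<in>\<Gamma> t x.
      g_norm g x (parallel_transport A g y x (f t y u) - f t x v) < \<epsilon> \<and> f0 t y u > f0 t x v - \<epsilon>"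
    if y: "rdist A g x y < ereal (min \<sigma> \<delta>)" and "u \<in> \<Gamma> t y" for y u
  proof -
    have "rdist A g x y < ereal \<sigma>" "rdist A g x y < ereal \<delta>"
      using y by (auto intro: less_le_trans)
    moreover from this \<open>u \<in> \<Gamma> t y\<close> obtain v where "v \<in> \<Gamma> t x" "dist v u < \<sigma>"
      using \<delta> by fastforce
    ultimately show ?thesis
      using * by blast
  qed
  ultimately show "\<exists>\<delta>>0. ereal \<delta> < inj_radius A g x \<and>
      (\<forall>y. rdist A g x y < ereal \<delta> \<longrightarrow> (\<forall>u\<in>\<Gamma> t y. \<exists>v\<in>\<Gamma> t x.
        g_norm g x (parallel_transport A g y x (f t y u) - f t x v) < \<epsilon> \<and>
        f0 t y u > f0 t x v - \<epsilon>))"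
    using \<sigma>(1) \<open>\<delta> > 0\<close> by (intro exI[of _ "min \<sigma> \<delta>"]) auto
  \<comment> \<open>Both points and both controls coincide now, so \<open>*\<close> compares a
    vector with its own transport.\<close>
  have "rdist A g x x < ereal \<sigma>"
    using rdist_refl_le[of g A x] M \<sigma>(1)
    by (auto simp: riemannian_manifold_def riemannian_metric_def intro: le_less_trans)
  then show "g_norm g x (parallel_transport A g x x (f t x u) - f t x u) < \<epsilon>" for u
    using * \<sigma>(1) by simp
qed

text \<open>The control set is the same at all points, so each control is matched by itself.\<close>

lemma cesari_type_if_cond_A4:
  assumes M: "riemannian_manifold A g" and A4: "cond_A4 A g f0 f \<Gamma> t"
    and cc: "\<And>x. convex (extended_velocities f0 f \<Gamma> t x)"
      "\<And>x. closed (extended_velocities f0 f \<Gamma> t x)"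
  shows "cesari_type A g (extended_velocities f0 f \<Gamma> t)"
proof (rule cesari_type_extended_velocities[OF M _ _ cc])
  fix x and \<epsilon> :: real
  assume "\<epsilon> > 0"
  then obtain \<sigma> where \<sigma>: "\<sigma> > 0" "ereal \<sigma> < inj_radius A g x"
    and *: "\<And>y u. rdist A g x y < ereal \<sigma> \<Longrightarrow>
      g_norm g x (parallel_transport A g y x (f t y u) - f t x u) < \<epsilon> \<and>
      f0 t y u > f0 t x u - \<epsilon>"
    using A4 unfolding cond_A4_def by metis
  obtain G where "\<And>x. \<Gamma> t x = G"
    using A4 unfolding cond_A4_def by blast
  with \<sigma> * show "\<exists>\<delta>>0. ereal \<delta> < inj_radius A g x \<and>
      (\<forall>y. rdist A g x y < ereal \<delta> \<longrightarrow> (\<forall>u\<in>\<Gamma> t y. \<exists>v\<in>\<Gamma> t x.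
        g_norm g x (parallel_transport A g y x (f t y u) - f t x v) < \<epsilon> \<and>
        f0 t y u > f0 t x v - \<epsilon>))"
    by metis
  have "rdist A g x x < ereal \<sigma>"
    using rdist_refl_le[of g A x] M \<sigma>(1)
    by (auto simp: riemannian_manifold_def riemannian_metric_def intro: le_less_trans)
  then show "g_norm g x (parallel_transport A g x x (f t x u) - f t x u) < \<epsilon>" for u
    using * by simp
qed

theorem proposition2p1:
  fixes A :: "('m::{t2_space, second_countable_topology}, 'n::finite) chart set"
    and g :: "'m \<Rightarrow> real ^ 'n \<Rightarrow> real ^ 'n \<Rightarrow> real"
    and T :: real
    and f0 :: "real \<Rightarrow> 'm \<Rightarrow> 'u::metric_space \<Rightarrow> real"
    and f :: "real \<Rightarrow> 'm \<Rightarrow> 'u \<Rightarrow> real ^ 'n"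
    and \<Gamma> :: "real \<Rightarrow> 'm \<Rightarrow> 'u set"
  assumes "riemannian_manifold A g"
    and "complete_riemannian A g"
    and "T > 0"
    and "AE t in lebesgue_on {0<..<T}. cond_A3 A g f0 f \<Gamma> t \<or> cond_A4 A g f0 f \<Gamma> t"
  shows "AE t in lebesgue_on {0<..<T}.
    cesari_type A g (extended_velocities f0 f \<Gamma> t) \<longleftrightarrow>
    (\<forall>x. convex (extended_velocities f0 f \<Gamma> t x) \<and> closed (extended_velocities f0 f \<Gamma> t x))"
proof (rule AE_mp[OF assms(4)], intro AE_I2 impI iffI allI)
  \<comment> \<open>The equivalence is proved separately for each \<open>t\<close> at which a
    condition holds; the exceptional null set is carried over.\<close>
  fix t x
  assume "cesari_type A g (extended_velocities f0 f \<Gamma> t)"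
  then show "convex (extended_velocities f0 f \<Gamma> t x) \<and> closed (extended_velocities f0 f \<Gamma> t x)"
    by (rule convex_closed_if_cesari_type)
next
  fix t
  assume "cond_A3 A g f0 f \<Gamma> t \<or> cond_A4 A g f0 f \<Gamma> t"
    and "\<forall>x. convex (extended_velocities f0 f \<Gamma> t x) \<and> closed (extended_velocities f0 f \<Gamma> t x)"
  then show "cesari_type A g (extended_velocities f0 f \<Gamma> t)"
    using cesari_type_if_cond_A3[OF assms(1)] cesari_type_if_cond_A4[OF assms(1)] by blast
qed

end
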